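(* Let $n,p\ge 1$ be integers, and let $a,b_1,\dots,b_n,c_1,\dots,c_n$ be complex parameters with $a\notin\{1,2,3,\dots\}$ and $c_i\notin\{0,-1,-2,\dots\}$ for all $i$. Write $x=(x_1,\dots,x_n)$, $y=(y_1,\dots,y_p)$. Then, as an identity of formal power series in $x_1,\dots,x_n,y_1,\dots,y_p$, $$\mathrm{H}_A^{(n,p)}(a,b_1,\dots,b_n;c_1,\dots,c_n;x,y)=F_A^{(n)}(a,b_1,\dots,b_n;c_1,\dots,c_n;x)\;{}_0F_p(1-a;-y)$$ $$+\sum_{k=1}^{\infty}\sum_{l=1}^{k}\ \sum_{\substack{i_1,\dots,i_n\ge 0,\ j_1,\dots,j_p\ge 0\\ i_1+\dots+i_n=k,\ j_1+\dots+j_p=l}}\binom{k-1}{l-1}\frac{(-1)^{k+l}\,k!\,(b_1)_{i_1}\cdots(b_n)_{i_n}}{(1-a)_l\,(c_1)_{i_1}\cdots(c_n)_{i_n}}\,\frac{x_1^{i_1}}{i_1!}\cdots\frac{x_n^{i_n}}{i_n!}\,\frac{y_1^{j_1}}{j_1!}\cdots\frac{y_p^{j_p}}{j_p!}$$ $$\cdot F_A^{(n)}(a+k,b_1+i_1,\dots,b_n+i_n;c_1+i_1,\dots,c_n+i_n;x)\;{}_0F_p(1-a+l;-y),$$ where $-y=(-y_1,\dots,-y_p)$.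
   Context: The Pochhammer symbol is $(\kappa)_\nu=\Gamma(\kappa+\nu)/\Gamma(\kappa)$; for an integer $l\ge 1$, $(\kappa)_l=\kappa(\kappa+1)\cdots(\kappa+l-1)$, $(\kappa)_0=1$, and $(\kappa)_{-l}=(-1)^l/(1-\kappa)_l$. The functions involved are the following power series. Confluent hypergeometric function of $n+p$ variables: $$\mathrm{H}_A^{(n,p)}(a,b_1,\dots,b_n;c_1,\dots,c_n;x,y)=\sum_{m_1,\dots,m_{n+p}=0}^{\infty}\frac{(a)_{m_1+\dots+m_n-m_{n+1}-\dots-m_{n+p}}\,(b_1)_{m_1}\cdots(b_n)_{m_n}}{m_1!\cdots m_{n+p}!\,(c_1)_{m_1}\cdots(c_n)_{m_n}}\,x_1^{m_1}\cdots x_n^{m_n}\,y_1^{m_{n+1}}\cdots y_p^{m_{n+p}}.$$ Lauricella function: $$F_A^{(n)}(a,b_1,\dots,b_n;c_1,\dots,c_n;x)=\sum_{m_1,\dots,m_n=0}^{\infty}\frac{(a)_{m_1+\dots+m_n}(b_1)_{m_1}\cdots(b_n)_{m_n}}{m_1!\cdots m_n!\,(c_1)_{m_1}\cdots(c_n)_{m_n}}\,x_1^{m_1}\cdots x_n^{m_n}.$$ The paper's notation ${}_0F_p$ (here $p$ is the number of variables; this is not the classical generalized hypergeometric function with $p$ lower parameters): $${}_0F_p(c;y)=\sum_{j_1,\dots,j_p=0}^{\infty}\frac{1}{(c)_{j_1+\dots+j_p}}\,\frac{y_1^{j_1}}{j_1!}\cdots\frac{y_p^{j_p}}{j_p!}.$$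 The infinite sum over $k$ is well defined as a formal power series, because the $k$-th term contains only monomials of total degree at least $k$ in $x$. *)

theory Defs
  imports Complex_Main "HOL-Library.Nonpos_Ints"
begin

text \<open>
  The variables are indexed by a finite type \<open>'v\<close>; a monomial is its exponent function
  \<open>'v \<Rightarrow> nat\<close>, and a formal power series is its coefficient function.
\<close>

typedef ('v, 'a) mfps = "UNIV :: (('v \<Rightarrow> nat) \<Rightarrow> 'a) set"
  morphisms mfps_coeff Abs_mfps
  by simp

lemma mfps_coeff_Abs [simp]: "mfps_coeff (Abs_mfps f) = f"
  by (simp add: Abs_mfps_inverse)

lemma mfps_eqI: "(\<And>m. mfps_coeff f m = mfps_coeff g m) \<Longrightarrow> f = g"
  by (metis ext mfps_coeff_inverse)

definition exp_splits :: "('v \<Rightarrow> nat) \<Rightarrow> (('v \<Rightarrow> nat) \<times> ('v \<Rightarrow> nat)) set" where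
  "exp_splits m = {(s, t). (\<lambda>v. s v + t v) = m}"

lemma finite_exp_below: "finite {s :: 'v::finite \<Rightarrow> nat. \<forall>v. s v \<le> m v}"
proof (rule finite_subset)
  show "{s. \<forall>v. s v \<le> m v} \<subseteq> {s. \<forall>v. s v \<in> {..(\<Sum>w\<in>UNIV. m w)}}"
  proof clarsimp
    fix s v assume "\<forall>v. s v \<le> m v"
    moreover have "m v \<le> (\<Sum>w\<in>UNIV. m w)"
      by (rule member_le_sum) auto
    ultimately show "s v \<le> (\<Sum>w\<in>UNIV. m w)"
      using order_trans by blast
  qed
  show "finite {s :: 'v \<Rightarrow> nat. \<forall>v. s v \<in> {..(\<Sum>w\<in>UNIV. m w)}}"
    using finite_set_of_finite_funs[of "UNIV :: 'v set" "{..(\<Sum>w\<in>UNIV. m w)}"] by simp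
qed

lemma finite_exp_splits [simp]: "finite (exp_splits (m :: 'v::finite \<Rightarrow> nat))"
  by (rule finite_subset[OF _ finite_cartesian_product[OF finite_exp_below[of m] finite_exp_below[of m]]])
     (auto simp: exp_splits_def)

instantiation mfps :: (finite, comm_ring_1) comm_ring_1
begin

definition zero_mfps :: "('a, 'b) mfps" where
  "0 = Abs_mfps (\<lambda>m. 0)"

definition one_mfps :: "('a, 'b) mfps" where
  "1 = Abs_mfps (\<lambda>m. if m = (\<lambda>_. 0) then 1 else 0)"

definition plus_mfps :: "('a, 'b) mfps \<Rightarrow> ('a, 'b) mfps \<Rightarrow> ('a, 'b) mfps" where
  "f + g = Abs_mfps (\<lambda>m. mfps_coeff f m + mfps_coeff g m)"

definition minus_mfps :: "('a, 'b) mfps \<Rightarrow> ('a, 'b) mfps \<Rightarrow> ('a, 'b) mfps" where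
  "f - g = Abs_mfps (\<lambda>m. mfps_coeff f m - mfps_coeff g m)"

definition uminus_mfps :: "('a, 'b) mfps \<Rightarrow> ('a, 'b) mfps" where
  "- f = Abs_mfps (\<lambda>m. - mfps_coeff f m)"

definition times_mfps :: "('a, 'b) mfps \<Rightarrow> ('a, 'b) mfps \<Rightarrow> ('a, 'b) mfps" where
  "f * g = Abs_mfps (\<lambda>m. \<Sum>(s, t)\<in>exp_splits m. mfps_coeff f s * mfps_coeff g t)"

instance
proof
  fix f g h :: "('a, 'b) mfps"
  show "f + g + h = f + (g + h)" "f + g = g + f" "0 + f = f" "- f + f = 0" "f - g = f + - g"
    by (simp_all add: plus_mfps_def zero_mfps_def uminus_mfps_def minus_mfps_def
                      mfps_coeff_inverse algebra_simps)
  show "f * g = g * f"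
    unfolding times_mfps_def
    by (rule arg_cong[of _ _ Abs_mfps], rule ext, rule sum.reindex_bij_witness[of _ prod.swap prod.swap])
       (auto simp: exp_splits_def mult.commute add.commute)
  show "(f + g) * h = f * h + g * h"
    by (simp add: times_mfps_def plus_mfps_def distrib_right sum.distrib split_def)
  show "1 * f = f"
  proof (rule mfps_eqI)
    fix m :: "'a \<Rightarrow> nat"
    have "mfps_coeff (1 * f) m =
        (\<Sum>x\<in>exp_splits m. if x = ((\<lambda>_. 0), m) then mfps_coeff f m else 0)"
      unfolding times_mfps_def one_mfps_def mfps_coeff_Abs
      by (rule sum.cong) (auto simp: exp_splits_def split: if_splits)
    also have "\<dots> = mfps_coeff f m"
      by (simp add: sum.delta') (simp add: exp_splits_def)
    finally show "mfps_coeff (1 * f) m = mfps_coeff f m" .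
  qed
  show "f * g * h = f * (g * h)"
  proof (rule mfps_eqI)
    fix m :: "'a \<Rightarrow> nat"
    have "mfps_coeff (f * g * h) m = (\<Sum>(x, y)\<in>(SIGMA x:exp_splits m. exp_splits (fst x)).
        mfps_coeff f (fst y) * mfps_coeff g (snd y) * mfps_coeff h (snd x))"
      by (simp add: times_mfps_def sum_distrib_right split_def sum.Sigma)
    also have "\<dots> = (\<Sum>(x, y)\<in>(SIGMA x:exp_splits m. exp_splits (snd x)).
        mfps_coeff f (fst x) * (mfps_coeff g (fst y) * mfps_coeff h (snd y)))"
      by (rule sum.reindex_bij_witness[of _
            "\<lambda>((s, t), (u, w)). ((\<lambda>v. s v + u v, w), (s, u))"
            "\<lambda>((s, t), (u, w)). ((u, \<lambda>v. w v + t v), (w, t))"])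
         (auto simp: exp_splits_def mult.assoc add.assoc)
    also have "\<dots> = mfps_coeff (f * (g * h)) m"
      by (simp add: times_mfps_def sum_distrib_left split_def sum.Sigma)
    finally show "mfps_coeff (f * g * h) m = mfps_coeff (f * (g * h)) m" .
  qed
  show "(0 :: ('a, 'b) mfps) \<noteq> 1"
  proof
    assume "(0 :: ('a, 'b) mfps) = 1"
    then have "mfps_coeff (0 :: ('a, 'b) mfps) (\<lambda>_. 0) = mfps_coeff 1 (\<lambda>_. 0)"
      by simp
    then show False
      by (simp add: zero_mfps_def one_mfps_def)
  qed
qed

end

definition mfps_const :: "'a \<Rightarrow> ('v::finite, 'a::comm_ring_1) mfps" where
  "mfps_const c = Abs_mfps (\<lambda>m. if m = (\<lambda>_. 0) then c else 0)"

definition mfps_X :: "'v \<Rightarrow> ('v::finite, 'a::comm_ring_1) mfps" where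
  "mfps_X v = Abs_mfps (\<lambda>m. if m = (\<lambda>w. if w = v then 1 else 0) then 1 else 0)"

text \<open>
  The series obtained by renaming each variable \<open>v\<close> to \<open>e v\<close>, for an injective renaming \<open>e\<close>.
  With \<open>e = Inl\<close> and \<open>e = Inr\<close>, a series in \<open>x\<close> alone or in \<open>y\<close> alone is regarded as a series
  in \<open>(x, y)\<close>.
\<close>

definition mfps_rename :: "('v \<Rightarrow> 'w) \<Rightarrow> ('v, 'a) mfps \<Rightarrow> ('w, 'a::zero) mfps" where
  "mfps_rename e f =
     Abs_mfps (\<lambda>m. if \<forall>w. w \<notin> range e \<longrightarrow> m w = 0 then mfps_coeff f (m \<circ> e) else 0)"

text \<open>The substitution \<open>y \<mapsto> -y\<close> of all variables at once.\<close>

definition mfps_neg_arg :: "('v::finite, 'a::comm_ring_1) mfps \<Rightarrow> ('v, 'a) mfps" where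
  "mfps_neg_arg f = Abs_mfps (\<lambda>m. (-1) ^ (\<Sum>v\<in>UNIV. m v) * mfps_coeff f m)"

text \<open>
  Formal summation of a family of series: every monomial occurs in only finitely many members,
  and the coefficients are added up.
\<close>

definition mfps_has_sum :: "('i \<Rightarrow> ('v, 'a::comm_monoid_add) mfps) \<Rightarrow> 'i set \<Rightarrow> ('v, 'a) mfps \<Rightarrow> bool" where
  "mfps_has_sum T K S \<longleftrightarrow>
     (\<forall>m. finite {k\<in>K. mfps_coeff (T k) m \<noteq> 0} \<and>
          mfps_coeff S m = (\<Sum>k\<in>{k\<in>K. mfps_coeff (T k) m \<noteq> 0}. mfps_coeff (T k) m))"


definition poch_int :: "complex \<Rightarrow> int \<Rightarrow> complex" where
  "poch_int \<kappa> \<nu> =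
     (if \<nu> \<ge> 0 then pochhammer \<kappa> (nat \<nu>)
      else (-1) ^ nat (- \<nu>) / pochhammer (1 - \<kappa>) (nat (- \<nu>)))"

text \<open>In the variables \<open>'n + 'p\<close>, the variable \<open>Inl i\<close> is \<open>x\<^sub>i\<close> and \<open>Inr j\<close> is \<open>y\<^sub>j\<close>.\<close>

definition H_A :: "complex \<Rightarrow> ('n \<Rightarrow> complex) \<Rightarrow> ('n \<Rightarrow> complex) \<Rightarrow> ('n::finite + 'p::finite, complex) mfps" where
  "H_A a b c = Abs_mfps (\<lambda>m.
     poch_int a ((\<Sum>i\<in>UNIV. int (m (Inl i))) - (\<Sum>j\<in>UNIV. int (m (Inr j))))
       * (\<Prod>i\<in>UNIV. pochhammer (b i) (m (Inl i)))
     / ((\<Prod>v\<in>UNIV. fact (m v)) * (\<Prod>i\<in>UNIV. pochhammer (c i) (m (Inl i)))))"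

definition F_A :: "complex \<Rightarrow> ('n \<Rightarrow> complex) \<Rightarrow> ('n \<Rightarrow> complex) \<Rightarrow> ('n::finite, complex) mfps" where
  "F_A a b c = Abs_mfps (\<lambda>m.
     pochhammer a (\<Sum>i\<in>UNIV. m i) * (\<Prod>i\<in>UNIV. pochhammer (b i) (m i))
     / ((\<Prod>i\<in>UNIV. fact (m i)) * (\<Prod>i\<in>UNIV. pochhammer (c i) (m i))))"

text \<open>Here \<open>'p\<close> indexes the variables; there is a single lower parameter.\<close>

definition F_0p :: "complex \<Rightarrow> ('p::finite, complex) mfps" where
  "F_0p c = Abs_mfps (\<lambda>m.
     1 / pochhammer c (\<Sum>j\<in>UNIV. m j) * (\<Prod>j\<in>UNIV. 1 / fact (m j)))"

end

theory Submission
  imports Defs "HOL-Library.FuncSet" "HOL-Computational_Algebra.Polynomial"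
begin

text \<open>
  Both sides are compared coefficient by coefficient. Fix a monomial
  \<open>x\<^sup>\<mu> y\<^sup>\<nu>\<close> and put \<open>M = |\<mu>|\<close>, \<open>N = |\<nu>|\<close>. Because
  \<open>(\<kappa>)\<^sub>r (\<kappa> + r)\<^sub>s = (\<kappa>)\<^sub>r\<^sub>+\<^sub>s\<close>, the shifted parameters in each term of the expansion recombine with
  the prefactors: every term contributes the common weight
  \<open>(b)\<^sub>\<mu> / (\<mu>! (c)\<^sub>\<mu>) \<sqdot> (-1)\<^sup>N / ((1 - a)\<^sub>N \<nu>!)\<close>, times a factor that sees the multi-indices
  \<open>i\<close>, \<open>j\<close> only through products of binomial coefficients (\<open>mfps_coeff_decomp_term\<close>).
  Vandermonde's identity for multi-indices (\<open>sum_prod_choose\<close>) then reduces the sums over \<open>i\<close> and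
  \<open>j\<close> to \<open>M choose k\<close> and \<open>N choose l\<close>, so that no trace of the individual variables is left.

  What remains is an identity in \<open>a\<close>, \<open>M\<close>, \<open>N\<close> alone (\<open>poch_int_expansion\<close>). The sum over \<open>l\<close> is again
  of Vandermonde type and turns \<open>k!\<close> into \<open>(N)\<^sub>k\<close>, and the sum over \<open>k\<close> becomes the Chu-Vandermonde
  evaluation \<open>(a)\<^sub>M \<sqdot> \<^sub>2F\<^sub>1(-M, N; a; 1) = (a - N)\<^sub>M\<close>, written without denominators in
  \<open>sum_alternating_choose_pochhammer\<close>. Finally \<open>(a - N)\<^sub>M = (a)\<^sub>M\<^sub>-\<^sub>N (-1)\<^sup>N (1 - a)\<^sub>N\<close>, which is where
  \<open>a\<close> must avoid the positive integers.
\<close>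

section \<open>Scalar identities\<close>

text \<open>
  The Chu-Vandermonde sum with the denominators \<open>(a)\<^sub>k\<close> cleared, which makes it valid in every
  commutative ring. Pascal's rule splits the sum for \<open>Suc M\<close> into two sums with the same summands up
  to the factors \<open>a + k\<close> and \<open>- (x + k)\<close>; these add up to \<open>a - x\<close>, independently of \<open>k\<close>, and the
  sum for \<open>M\<close> at \<open>a + 1\<close> is left.
\<close>

lemma sum_alternating_choose_pochhammer:
  fixes a x :: "'a::comm_ring_1"
  shows "(\<Sum>k\<le>M. (-1) ^ k * of_nat (M choose k) * pochhammer x k * pochhammer (a + of_nat k) (M - k))
           = pochhammer (a - x) M"
proof (induction M arbitrary: a)
  case 0
  show ?case by simp
next
  case (Suc M)
  define g where "g k = (-1) ^ k * of_nat (M choose k) * pochhammer x k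
      * pochhammer (a + 1 + of_nat k) (M - k)" for k
  have "(\<Sum>k\<le>Suc M. (-1) ^ k * of_nat (Suc M choose k) * pochhammer x k * pochhammer (a + of_nat k) (Suc M - k))
      = (\<Sum>k\<le>Suc M. (-1) ^ k * of_nat (M choose k) * pochhammer x k * pochhammer (a + of_nat k) (Suc M - k))
        + (\<Sum>k\<le>M. (-1) ^ Suc k * of_nat (M choose k) * pochhammer x (Suc k) * pochhammer (a + of_nat (Suc k)) (M - k))"
    unfolding sum.atMost_Suc_shift add.assoc sum.distrib [symmetric]
    by (intro arg_cong2[where f = "(+)"] sum.cong) (simp_all add: algebra_simps)
  also have "(\<Sum>k\<le>Suc M. (-1) ^ k * of_nat (M choose k) * pochhammer x k * pochhammer (a + of_nat k) (Suc M - k))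
      = (\<Sum>k\<le>M. (a + of_nat k) * g k)"
    by (auto simp: g_def Suc_diff_le pochhammer_rec binomial_eq_0 algebra_simps intro!: sum.cong)
  also have "(\<Sum>k\<le>M. (-1) ^ Suc k * of_nat (M choose k) * pochhammer x (Suc k) * pochhammer (a + of_nat (Suc k)) (M - k))
      = (\<Sum>k\<le>M. - (x + of_nat k) * g k)"
    by (auto simp: g_def pochhammer_rec' algebra_simps intro!: sum.cong)
  also have "(\<Sum>k\<le>M. (a + of_nat k) * g k) + (\<Sum>k\<le>M. - (x + of_nat k) * g k)
      = (a - x) * (\<Sum>k\<le>M. g k)"
    by (simp add: sum.distrib [symmetric] sum_distrib_left algebra_simps)
  also have "(\<Sum>k\<le>M. g k) = pochhammer (a + 1 - x) M"
    using Suc.IH[of "a + 1"] by (simp add: g_def)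
  finally show ?case
    by (simp add: pochhammer_rec algebra_simps)
qed

lemma sum_choose_mult_choose:
  assumes "k \<ge> 1"
  shows "(\<Sum>l = 1..k. ((k - 1) choose (l - 1)) * (N choose l)) = (N + k - 1) choose k"
proof -
  have "(\<Sum>l = 1..k. ((k - 1) choose (l - 1)) * (N choose l))
      = (\<Sum>l = 1..k. (N choose l) * ((k - 1) choose (k - l)))"
  proof (rule sum.cong)
    fix l assume "l \<in> {1..k}"
    then have "(k - 1) choose (l - 1) = (k - 1) choose (k - l)"
      using binomial_symmetric[of "l - 1" "k - 1"] by auto
    then show "((k - 1) choose (l - 1)) * (N choose l) = (N choose l) * ((k - 1) choose (k - l))"
      by simp
  qed simp
  also have "\<dots> = (\<Sum>l\<le>k. (N choose l) * ((k - 1) choose (k - l)))"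
    using assms by (intro sum.mono_neutral_left) (auto simp: not_less_eq_eq)
  also have "\<dots> = (N + k - 1) choose k"
    using assms by (simp add: vandermonde)
  finally show ?thesis .
qed

lemma fact_mult_choose_eq_pochhammer:
  assumes "k \<ge> 1"
  shows "fact k * of_nat ((N + k - 1) choose k) = (pochhammer (of_nat N) k :: 'a::field_char_0)"
proof -
  have "of_nat ((N + k - 1) choose k) = (of_nat (N + k - 1) gchoose k :: 'a)"
    by (simp add: binomial_gbinomial)
  also have "\<dots> = pochhammer (of_nat N) k / fact k"
    using assms by (simp add: gbinomial_pochhammer' of_nat_diff)
  finally show ?thesis by simp
qed

lemma pochhammer_one_minus:
  fixes a :: "'a::comm_ring_1"
  shows "(-1) ^ N * pochhammer (1 - a) N = pochhammer (a - of_nat N) N"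
  using pochhammer_minus[of "a - 1" N]
  by (simp add: mult.assoc [symmetric] power_mult_distrib [symmetric])

text \<open>
  Both signs of \<open>M - N\<close> come from splitting a product of consecutive factors starting at
  \<open>a - N\<close>: if \<open>N \<le> M\<close>, the first \<open>N\<close> factors of \<open>(a - N)\<^sub>M\<close> are split off; otherwise the first
  \<open>M\<close> factors of \<open>(a - N)\<^sub>N\<close>.
\<close>

lemma poch_int_diff:
  assumes "a \<notin> of_nat ` {1..}"
  shows "poch_int a (int M - int N)
    = (-1) ^ N / pochhammer (1 - a) N * pochhammer (a - of_nat N) M"
proof -
  have nz: "pochhammer (1 - a) r \<noteq> 0" for r
  proof
    assume "pochhammer (1 - a) r = 0"
    then obtain k where "1 - a = - of_nat k"
      by (auto simp: pochhammer_eq_0_iff)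
    then have "a = of_nat (Suc k)"
      by (simp add: algebra_simps)
    then have "a \<in> of_nat ` {1..}"
      by (intro image_eqI[of _ _ "Suc k"]) auto
    then show False
      using assms by simp
  qed
  have "poch_int a (int M - int N) * pochhammer (a - of_nat N) N = pochhammer (a - of_nat N) M"
  proof (cases "N \<le> M")
    case True
    then show ?thesis
      using pochhammer_product[of N M "a - of_nat N"] by (simp add: poch_int_def nat_diff_distrib')
  next
    case False
    then have n: "nat (- (int M - int N)) = N - M" by simp
    have shift: "a - of_nat N + of_nat M = a - of_nat (N - M)"
      using False by (simp add: of_nat_diff)
    have "pochhammer (a - of_nat N) N
        = pochhammer (a - of_nat N) M * pochhammer (a - of_nat (N - M)) (N - M)"
      using False pochhammer_product[of M N "a - of_nat N", unfolded shift] by simp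
    also have "pochhammer (a - of_nat (N - M)) (N - M) = (-1) ^ (N - M) * pochhammer (1 - a) (N - M)"
      by (simp only: pochhammer_one_minus)
    finally show ?thesis
      using False nz[of "N - M"] unfolding poch_int_def n
      by (simp add: mult.assoc [symmetric] power_mult_distrib [symmetric])
  qed
  then have eq: "poch_int a (int M - int N) * ((-1) ^ N * pochhammer (1 - a) N) = pochhammer (a - of_nat N) M"
    by (simp only: pochhammer_one_minus)
  have "((-1) ^ N * (-1) ^ N :: complex) = 1"
    by (simp flip: power_mult_distrib)
  then have "poch_int a (int M - int N)
      = (-1) ^ N / pochhammer (1 - a) N * (poch_int a (int M - int N) * ((-1) ^ N * pochhammer (1 - a) N))"
    using nz[of N] by simp
  then show ?thesis
    unfolding eq .
qed

lemma poch_int_expansion: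
  assumes "a \<notin> of_nat ` {1..}"
  shows "poch_int a (int M - int N) = (-1) ^ N / pochhammer (1 - a) N *
    (pochhammer a M + (\<Sum>k = 1..M. \<Sum>l = 1..k. of_nat ((k - 1) choose (l - 1)) * ((-1) ^ k * fact k)
       * pochhammer (a + of_nat k) (M - k) * of_nat (M choose k) * of_nat (N choose l)))"
proof -
  have inner: "(\<Sum>l = 1..k. of_nat ((k - 1) choose (l - 1)) * ((-1) ^ k * fact k)
       * pochhammer (a + of_nat k) (M - k) * of_nat (M choose k) * of_nat (N choose l))
     = (-1) ^ k * of_nat (M choose k) * pochhammer (of_nat N) k * pochhammer (a + of_nat k) (M - k)"
    if "k \<in> {1..M}" for k
  proof -
    have "(\<Sum>l = 1..k. of_nat ((k - 1) choose (l - 1)) * ((-1) ^ k * fact k)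
         * pochhammer (a + of_nat k) (M - k) * of_nat (M choose k) * of_nat (N choose l))
       = (-1) ^ k * of_nat (M choose k)
          * (fact k * of_nat (\<Sum>l = 1..k. ((k - 1) choose (l - 1)) * (N choose l)))
          * pochhammer (a + of_nat k) (M - k)"
      by (simp add: sum_distrib_left sum_distrib_right mult_ac)
    also have "fact k * of_nat (\<Sum>l = 1..k. ((k - 1) choose (l - 1)) * (N choose l))
        = (pochhammer (of_nat N) k :: complex)"
      using that sum_choose_mult_choose[of k N] fact_mult_choose_eq_pochhammer[of k N] by simp
    finally show ?thesis .
  qed
  have "pochhammer (a - of_nat N) M
      = (\<Sum>k\<le>M. (-1) ^ k * of_nat (M choose k) * pochhammer (of_nat N) k * pochhammer (a + of_nat k) (M - k))"
    by (rule sum_alternating_choose_pochhammer [symmetric])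
  also have "\<dots> = pochhammer a M
      + (\<Sum>k = 1..M. (-1) ^ k * of_nat (M choose k) * pochhammer (of_nat N) k * pochhammer (a + of_nat k) (M - k))"
    by (simp add: atMost_atLeast0 sum.atLeast_Suc_atMost)
  also have "(\<Sum>k = 1..M. (-1) ^ k * of_nat (M choose k) * pochhammer (of_nat N) k * pochhammer (a + of_nat k) (M - k))
      = (\<Sum>k = 1..M. \<Sum>l = 1..k. of_nat ((k - 1) choose (l - 1)) * ((-1) ^ k * fact k)
       * pochhammer (a + of_nat k) (M - k) * of_nat (M choose k) * of_nat (N choose l))"
    by (rule sum.cong[OF refl], rule inner [symmetric])
  finally show ?thesis
    using poch_int_diff[OF assms, of M N] by simp
qed

section \<open>Multi-indices\<close>

lemma finite_exp_degree [simp]: "finite {i :: 'v::finite \<Rightarrow> nat. (\<Sum>s\<in>UNIV. i s) = k}"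
proof (rule finite_subset[OF _ finite_exp_below[of "\<lambda>_. k"]])
  show "{i :: 'v \<Rightarrow> nat. (\<Sum>s\<in>UNIV. i s) = k} \<subseteq> {i. \<forall>s. i s \<le> k}"
    using member_le_sum[of _ "UNIV :: 'v set"] by force
qed

lemma coeff_one_plus_X_power: "coeff ([:1, 1:] ^ n :: nat poly) j = n choose j"
proof (cases "j \<le> n")
  case True
  then show ?thesis
    by (simp add: coeff_linear_poly_power del: One_nat_def)
next
  case False
  then have "degree ([:1, 1 :: nat:] ^ n) < j"
    using degree_power_le[of "[:1, 1 :: nat:]" n] by simp
  with False show ?thesis
    by (simp add: coeff_eq_0)
qed

text \<open>
  Compare the coefficients of \<open>X\<^sup>k\<close> in \<open>(1 + X)\<^bsup>\<Sum>m\<^esup> = \<Prod>\<^sub>s (1 + X)\<^bsup>m s\<^esup>\<close>.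
\<close>

lemma sum_prod_choose:
  fixes m :: "'v::finite \<Rightarrow> nat"
  shows "(\<Sum>i\<in>{i. (\<Sum>s\<in>UNIV. i s) = k}. \<Prod>s\<in>UNIV. m s choose i s) = (\<Sum>s\<in>UNIV. m s) choose k"
proof -
  let ?E = "{i. \<forall>s. i s \<le> m s}"
  have E: "Pi\<^sub>E UNIV (\<lambda>s. {..m s}) = ?E"
    by (auto simp: PiE_def)
  have "[:1, 1:] ^ (\<Sum>s\<in>UNIV. m s) = (\<Prod>s\<in>UNIV. [:1, 1:] ^ m s :: nat poly)"
    by (simp add: power_sum)
  also have "\<dots> = (\<Prod>s\<in>UNIV. \<Sum>j\<le>m s. monom (m s choose j) j)"
  proof (rule prod.cong[OF refl], rule poly_eqI)
    fix s j
    show "coeff ([:1, 1:] ^ m s) j = coeff (\<Sum>j\<le>m s. monom (m s choose j) j) j"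
      by (simp add: coeff_sum coeff_one_plus_X_power del: One_nat_def)
  qed
  also have "\<dots> = (\<Sum>i\<in>?E. \<Prod>s\<in>UNIV. monom (m s choose i s) (i s))"
    by (simp add: prod_sum_PiE E)
  also have "\<dots> = (\<Sum>i\<in>?E. monom (\<Prod>s\<in>UNIV. m s choose i s) (\<Sum>s\<in>UNIV. i s))"
  proof (rule sum.cong[OF refl])
    fix i
    have "(\<Prod>s\<in>A. monom (m s choose i s) (i s)) = monom (\<Prod>s\<in>A. m s choose i s) (\<Sum>s\<in>A. i s)" for A
      by (induction A rule: infinite_finite_induct) (simp_all add: mult_monom del: One_nat_def)
    then show "(\<Prod>s\<in>UNIV. monom (m s choose i s) (i s)) = monom (\<Prod>s\<in>UNIV. m s choose i s) (\<Sum>s\<in>UNIV. i s)" .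
  qed
  finally have "coeff ([:1, 1:] ^ (\<Sum>s\<in>UNIV. m s)) k
      = (\<Sum>i\<in>?E. if (\<Sum>s\<in>UNIV. i s) = k then \<Prod>s\<in>UNIV. m s choose i s else 0)"
    by (simp add: coeff_sum)
  also have "\<dots> = (\<Sum>i\<in>?E \<inter> {i. (\<Sum>s\<in>UNIV. i s) = k}. \<Prod>s\<in>UNIV. m s choose i s)"
    by (simp add: finite_exp_below sum.inter_restrict)
  also have "\<dots> = (\<Sum>i\<in>{i. (\<Sum>s\<in>UNIV. i s) = k}. \<Prod>s\<in>UNIV. m s choose i s)"
    by (rule sum.mono_neutral_left) (auto simp: not_le intro!: binomial_eq_0)
  finally show ?thesis
    by (simp only: coeff_one_plus_X_power)
qed

section \<open>Coefficients of monomials and products\<close>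

lemma mfps_coeff_zero [simp]: "mfps_coeff (0 :: ('v::finite, 'a::comm_ring_1) mfps) m = 0"
  by (simp add: zero_mfps_def)

lemma mfps_coeff_add [simp]:
  "mfps_coeff (f + g :: ('v::finite, 'a::comm_ring_1) mfps) m = mfps_coeff f m + mfps_coeff g m"
  by (simp add: plus_mfps_def)

lemma mfps_coeff_sum [simp]:
  "mfps_coeff (\<Sum>x\<in>A. f x :: ('v::finite, 'a::comm_ring_1) mfps) m = (\<Sum>x\<in>A. mfps_coeff (f x) m)"
  by (induction A rule: infinite_finite_induct) simp_all

definition mfps_monom :: "'a \<Rightarrow> ('v \<Rightarrow> nat) \<Rightarrow> ('v::finite, 'a::comm_ring_1) mfps" where
  "mfps_monom c e = Abs_mfps (\<lambda>m. if m = e then c else 0)"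

lemma mfps_coeff_monom_mult:
  "mfps_coeff (mfps_monom c e * f) m
     = (if \<forall>v. e v \<le> m v then c * mfps_coeff f (\<lambda>v. m v - e v) else 0)"
proof -
  have "mfps_coeff (mfps_monom c e * f) m
      = (\<Sum>x\<in>exp_splits m. if x = (e, \<lambda>v. m v - e v) then c * mfps_coeff f (\<lambda>v. m v - e v) else 0)"
    unfolding times_mfps_def mfps_monom_def mfps_coeff_Abs
    by (rule sum.cong) (auto simp: exp_splits_def split: if_splits)
  also have "\<dots> = (if (e, \<lambda>v. m v - e v) \<in> exp_splits m then c * mfps_coeff f (\<lambda>v. m v - e v) else 0)"
    by (simp add: sum.delta')
  also have "(e, \<lambda>v. m v - e v) \<in> exp_splits m \<longleftrightarrow> (\<forall>v. e v \<le> m v)"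
    by (auto simp: exp_splits_def fun_eq_iff) (metis le_add1)
  finally show ?thesis .
qed

lemma mfps_monom_mult: "mfps_monom c d * mfps_monom c' e = mfps_monom (c * c') (\<lambda>v. d v + e v)"
proof (rule mfps_eqI)
  fix m
  have "(\<forall>v. d v \<le> m v) \<and> (\<lambda>v. m v - d v) = e \<longleftrightarrow> m = (\<lambda>v. d v + e v)"
    by (auto simp: fun_eq_iff) (metis le_add_diff_inverse)
  then show "mfps_coeff (mfps_monom c d * mfps_monom c' e) m = mfps_coeff (mfps_monom (c * c') (\<lambda>v. d v + e v)) m"
    unfolding mfps_coeff_monom_mult by (auto simp: mfps_monom_def)
qed

lemma mfps_const_eq_monom: "mfps_const c = mfps_monom c (\<lambda>_. 0)"
  by (simp add: mfps_const_def mfps_monom_def)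

lemma one_eq_mfps_monom: "1 = mfps_monom 1 (\<lambda>_. 0)"
  by (simp add: one_mfps_def mfps_monom_def)

lemma mfps_X_eq_monom: "mfps_X v = mfps_monom 1 (\<lambda>w. if w = v then 1 else 0)"
  by (simp add: mfps_X_def mfps_monom_def)

lemma mfps_X_power: "mfps_X v ^ n = mfps_monom 1 (\<lambda>w. if w = v then n else 0)"
proof (induction n)
  case 0
  show ?case by (simp add: one_eq_mfps_monom)
next
  case (Suc n)
  have "(\<lambda>w. (if w = v then 1 else 0) + (if w = v then n else 0)) = (\<lambda>w. if w = v then Suc n else 0)"
    by auto
  then show ?case
    by (simp only: power_Suc Suc.IH) (simp only: mfps_X_eq_monom mfps_monom_mult mult_1)
qed

lemma prod_mfps_monom:
  "(\<Prod>s\<in>A. mfps_monom (c s) (e s)) = mfps_monom (\<Prod>s\<in>A. c s) (\<lambda>v. \<Sum>s\<in>A. e s v)"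
  by (induction A rule: infinite_finite_induct) (simp_all add: one_eq_mfps_monom mfps_monom_mult)

lemma prod_const_X_power:
  "(\<Prod>s\<in>UNIV. mfps_const (c s) * mfps_X (e s) ^ i s)
    = mfps_monom (\<Prod>s\<in>UNIV. c s) (\<lambda>v. \<Sum>s\<in>UNIV. if v = e s then i s else 0)"
  by (simp add: mfps_const_eq_monom mfps_X_power mfps_monom_mult prod_mfps_monom)

text \<open>
  The two factors have disjoint sets of variables, so only one splitting of the exponent \<open>m\<close>
  contributes to the Cauchy product.
\<close>

lemma mfps_coeff_rename_mult:
  fixes f :: "('n::finite, 'a::comm_ring_1) mfps" and g :: "('p::finite, 'a) mfps"
  shows "mfps_coeff (mfps_rename Inl f * mfps_rename Inr g) m
     = mfps_coeff f (m \<circ> Inl) * mfps_coeff g (m \<circ> Inr)"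
proof -
  let ?s = "case_sum (m \<circ> Inl) (\<lambda>_. 0)" and ?t = "case_sum (\<lambda>_. 0) (m \<circ> Inr)"
  have [simp]: "?s \<circ> Inl = m \<circ> Inl" "?t \<circ> Inr = m \<circ> Inr"
    by (simp_all add: fun_eq_iff)
  have mem: "(?s, ?t) \<in> exp_splits m"
    by (auto simp: exp_splits_def fun_eq_iff split: sum.split)
  have Inl_iff: "(\<forall>w. w \<notin> range Inl \<longrightarrow> s w = 0) \<longleftrightarrow> (\<forall>j. s (Inr j) = 0)" for s :: "'n + 'p \<Rightarrow> nat"
    by (simp add: split_sum_all image_iff)
  have Inr_iff: "(\<forall>w. w \<notin> range Inr \<longrightarrow> s w = 0) \<longleftrightarrow> (\<forall>i. s (Inl i) = 0)" for s :: "'n + 'p \<Rightarrow> nat"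
    by (simp add: split_sum_all image_iff)
  have "mfps_coeff (mfps_rename Inl f * mfps_rename Inr g) m
      = (\<Sum>x\<in>exp_splits m. if x = (?s, ?t) then mfps_coeff f (m \<circ> Inl) * mfps_coeff g (m \<circ> Inr) else 0)"
    unfolding times_mfps_def mfps_rename_def mfps_coeff_Abs Inl_iff Inr_iff
  proof (rule sum.cong[OF refl], clarify)
    fix s t assume "(s, t) \<in> exp_splits m"
    then have m: "m v = s v + t v" for v
      by (auto simp: exp_splits_def)
    have "(\<forall>j. s (Inr j) = 0) \<and> (\<forall>i. t (Inl i) = 0) \<longleftrightarrow> (s, t) = (?s, ?t)"
      by (auto simp: fun_eq_iff m split: sum.splits)
    then show "(if \<forall>j. s (Inr j) = 0 then mfps_coeff f (s \<circ> Inl) else 0) *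
           (if \<forall>i. t (Inl i) = 0 then mfps_coeff g (t \<circ> Inr) else 0) =
           (if (s, t) = (?s, ?t) then mfps_coeff f (m \<circ> Inl) * mfps_coeff g (m \<circ> Inr) else 0)"
      by auto
  qed
  also have "\<dots> = mfps_coeff f (m \<circ> Inl) * mfps_coeff g (m \<circ> Inr)"
    by (simp add: sum.delta' mem)
  finally show ?thesis .
qed

section \<open>The expansion\<close>

lemma pochhammer_ratio_split:
  fixes b c :: "'a::field_char_0"
  assumes "i \<le> x"
  shows "pochhammer b i / (pochhammer c i * fact i)
      * (pochhammer (b + of_nat i) (x - i) / (fact (x - i) * pochhammer (c + of_nat i) (x - i)))
    = pochhammer b x / (fact x * pochhammer c x) * of_nat (x choose i)"
  by (simp add: pochhammer_product[OF assms, of b] pochhammer_product[OF assms, of c]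
      binomial_fact[OF assms] field_simps)

lemma mfps_coeff_F_A:
  "mfps_coeff (F_A a b c) x = pochhammer a (\<Sum>s\<in>UNIV. x s)
     * (\<Prod>s\<in>UNIV. pochhammer (b s) (x s) / (fact (x s) * pochhammer (c s) (x s)))"
  by (simp add: F_A_def prod_dividef prod.distrib)

lemma mfps_coeff_F_0p_neg:
  "mfps_coeff (mfps_neg_arg (F_0p c)) y
     = (-1) ^ (\<Sum>t\<in>UNIV. y t) / pochhammer c (\<Sum>t\<in>UNIV. y t) * (\<Prod>t\<in>UNIV. 1 / fact (y t))"
  by (simp add: F_0p_def mfps_neg_arg_def)

lemma mfps_coeff_H_A:
  "mfps_coeff (H_A a b c) m = poch_int a (int (\<Sum>s\<in>UNIV. m (Inl s)) - int (\<Sum>t\<in>UNIV. m (Inr t)))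
     * (\<Prod>s\<in>UNIV. pochhammer (b s) (m (Inl s)) / (fact (m (Inl s)) * pochhammer (c s) (m (Inl s))))
     * (\<Prod>t\<in>UNIV. 1 / fact (m (Inr t)))"
proof -
  have "(\<Prod>v\<in>UNIV. fact (m v)) = (\<Prod>s\<in>UNIV. fact (m (Inl s))) * (\<Prod>t\<in>UNIV. fact (m (Inr t)) :: complex)"
    by (simp add: UNIV_Plus_UNIV [symmetric] prod.Plus del: UNIV_Plus_UNIV)
  then show ?thesis
    by (simp add: H_A_def prod_dividef prod.distrib)
qed

text \<open>
  The summand of the quadruple sum in the theorem. It gets a name because its coefficients factor
  before any summation is carried out.
\<close>

definition decomp_term ::
  "complex \<Rightarrow> ('n::finite \<Rightarrow> complex) \<Rightarrow> ('n \<Rightarrow> complex) \<Rightarrow> nat \<Rightarrow> nat \<Rightarrow> ('n \<Rightarrow> nat) \<Rightarrow> ('p::finite \<Rightarrow> nat)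
     \<Rightarrow> ('n + 'p, complex) mfps" where
  "decomp_term a b c k l i j =
         mfps_const
           (of_nat ((k - 1) choose (l - 1))
             * ((-1) ^ (k + l) * fact k * (\<Prod>s\<in>UNIV. pochhammer (b s) (i s))
                / (pochhammer (1 - a) l * (\<Prod>s\<in>UNIV. pochhammer (c s) (i s)))))
         * (\<Prod>s\<in>UNIV. mfps_const (1 / fact (i s)) * mfps_X (Inl s) ^ i s)
         * (\<Prod>t\<in>UNIV. mfps_const (1 / fact (j t)) * mfps_X (Inr t) ^ j t)
         * mfps_rename Inl (F_A (a + of_nat k) (\<lambda>s. b s + of_nat (i s)) (\<lambda>s. c s + of_nat (i s)))
         * mfps_rename Inr (mfps_neg_arg (F_0p (1 - a + of_nat l)))"

text \<open>
  Stated with binomial coefficients instead of a case distinction: they vanish by themselves when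
  the monomial \<open>x\<^sup>i y\<^sup>j\<close> does not divide the monomial of \<open>m\<close>, and for the others they arise from
  \<open>1 / (r! (n - r)!)\<close>. The first three factors of the right-hand side do not depend on \<open>k\<close>, \<open>l\<close>, \<open>i\<close>, \<open>j\<close>.
\<close>

lemma mfps_coeff_decomp_term:
  fixes i :: "'n::finite \<Rightarrow> nat" and j :: "'p::finite \<Rightarrow> nat" and m :: "'n + 'p \<Rightarrow> nat"
  defines "M \<equiv> \<Sum>s\<in>UNIV. m (Inl s)" and "N \<equiv> \<Sum>t\<in>UNIV. m (Inr t)"
  assumes i: "(\<Sum>s\<in>UNIV. i s) = k" and j: "(\<Sum>t\<in>UNIV. j t) = l"
  shows "mfps_coeff (decomp_term a b c k l i j) m
    = (-1) ^ N / pochhammer (1 - a) N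
      * (\<Prod>s\<in>UNIV. pochhammer (b s) (m (Inl s)) / (fact (m (Inl s)) * pochhammer (c s) (m (Inl s))))
      * (\<Prod>t\<in>UNIV. 1 / fact (m (Inr t)))
      * (of_nat ((k - 1) choose (l - 1)) * ((-1) ^ k * fact k) * pochhammer (a + of_nat k) (M - k))
      * of_nat (\<Prod>s\<in>UNIV. m (Inl s) choose i s) * of_nat (\<Prod>t\<in>UNIV. m (Inr t) choose j t)"
proof -
  let ?C = "of_nat ((k - 1) choose (l - 1))
             * ((-1) ^ (k + l) * fact k * (\<Prod>s\<in>UNIV. pochhammer (b s) (i s))
                / (pochhammer (1 - a) l * (\<Prod>s\<in>UNIV. pochhammer (c s) (i s))))
             * (\<Prod>s\<in>UNIV. 1 / fact (i s)) * (\<Prod>t\<in>UNIV. 1 / fact (j t))"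
  let ?e = "case_sum i j"
  have exps: "(\<lambda>v. (\<Sum>s\<in>UNIV. if v = Inl s then i s else 0) + (\<Sum>t\<in>UNIV. if v = Inr t then j t else 0)) = ?e"
  proof
    fix v show "(\<Sum>s\<in>UNIV. if v = Inl s then i s else 0) + (\<Sum>t\<in>UNIV. if v = Inr t then j t else 0) = ?e v"
      by (cases v) simp_all
  qed
  have eq: "decomp_term a b c k l i j = mfps_monom ?C ?e
      * (mfps_rename Inl (F_A (a + of_nat k) (\<lambda>s. b s + of_nat (i s)) (\<lambda>s. c s + of_nat (i s)))
         * mfps_rename Inr (mfps_neg_arg (F_0p (1 - a + of_nat l))))"
    unfolding decomp_term_def prod_const_X_power
    by (simp add: mfps_const_eq_monom mfps_monom_mult exps mult.assoc)
  show ?thesis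
  proof (cases "\<forall>v. ?e v \<le> m v")
    case False
    then have "(\<exists>s. m (Inl s) < i s) \<or> (\<exists>t. m (Inr t) < j t)"
      by (simp add: split_sum_all not_le)
    then have "(\<Prod>s\<in>UNIV. m (Inl s) choose i s) = 0 \<or> (\<Prod>t\<in>UNIV. m (Inr t) choose j t) = 0"
      by (auto intro: binomial_eq_0)
    then show ?thesis
      using False unfolding eq mfps_coeff_monom_mult by auto
  next
    case True
    have ile: "i s \<le> m (Inl s)" for s using True[rule_format, of "Inl s"] by simp
    have jle: "j t \<le> m (Inr t)" for t using True[rule_format, of "Inr t"] by simp
    have sumi: "(\<Sum>s\<in>UNIV. m (Inl s) - i s) = M - k"
      using ile i by (simp add: sum_subtractf_nat M_def)
    have sumj: "(\<Sum>t\<in>UNIV. m (Inr t) - j t) = N - l"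
      using jle j by (simp add: sum_subtractf_nat N_def)
    have lN: "l \<le> N"
      unfolding N_def j [symmetric] using jle by (intro sum_mono) auto
    have X: "(\<Prod>s\<in>UNIV. pochhammer (b s) (i s)) / (\<Prod>s\<in>UNIV. pochhammer (c s) (i s)) * (\<Prod>s\<in>UNIV. 1 / fact (i s))
       * (\<Prod>s\<in>UNIV. pochhammer (b s + of_nat (i s)) (m (Inl s) - i s)
            / (fact (m (Inl s) - i s) * pochhammer (c s + of_nat (i s)) (m (Inl s) - i s)))
      = (\<Prod>s\<in>UNIV. pochhammer (b s) (m (Inl s)) / (fact (m (Inl s)) * pochhammer (c s) (m (Inl s))))
        * of_nat (\<Prod>s\<in>UNIV. m (Inl s) choose i s)"
      unfolding of_nat_prod prod_dividef [symmetric] prod.distrib [symmetric]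
      by (rule prod.cong) (use pochhammer_ratio_split[OF ile] in simp_all)
    have Y: "(\<Prod>t\<in>UNIV. 1 / fact (j t)) * (\<Prod>t\<in>UNIV. 1 / fact (m (Inr t) - j t))
      = (\<Prod>t\<in>UNIV. 1 / fact (m (Inr t))) * (of_nat (\<Prod>t\<in>UNIV. m (Inr t) choose j t) :: complex)"
      unfolding of_nat_prod prod.distrib [symmetric]
      by (rule prod.cong) (simp_all add: binomial_fact[OF jle])
    have Z: "(-1) ^ (k + l) / pochhammer (1 - a) l * ((-1) ^ (N - l) / pochhammer (1 - a + of_nat l) (N - l))
       = (-1) ^ k * ((-1) ^ N / pochhammer (1 - a) N)"
    proof -
      have "(-1) ^ (k + l) * (-1) ^ (N - l) = ((-1) ^ k * (-1) ^ N :: complex)"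
        using lN by (simp flip: power_add)
      then show ?thesis
        by (simp add: pochhammer_product[OF lN, of "1 - a"])
    qed
    have "mfps_coeff (decomp_term a b c k l i j) m
      = of_nat ((k - 1) choose (l - 1)) * fact k * pochhammer (a + of_nat k) (M - k)
      * ((\<Prod>s\<in>UNIV. pochhammer (b s) (i s)) / (\<Prod>s\<in>UNIV. pochhammer (c s) (i s)) * (\<Prod>s\<in>UNIV. 1 / fact (i s))
       * (\<Prod>s\<in>UNIV. pochhammer (b s + of_nat (i s)) (m (Inl s) - i s)
            / (fact (m (Inl s) - i s) * pochhammer (c s + of_nat (i s)) (m (Inl s) - i s))))
      * ((\<Prod>t\<in>UNIV. 1 / fact (j t)) * (\<Prod>t\<in>UNIV. 1 / fact (m (Inr t) - j t)))
      * ((-1) ^ (k + l) / pochhammer (1 - a) l * ((-1) ^ (N - l) / pochhammer (1 - a + of_nat l) (N - l)))"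
      using True unfolding eq mfps_coeff_monom_mult mfps_coeff_rename_mult mfps_coeff_F_A mfps_coeff_F_0p_neg
      by (simp add: sumi sumj mult_ac)
    then show ?thesis
      unfolding X Y Z by (simp add: mult_ac)
  qed
qed

definition decomp_summand ::
  "complex \<Rightarrow> ('n::finite \<Rightarrow> complex) \<Rightarrow> ('n \<Rightarrow> complex) \<Rightarrow> nat \<Rightarrow> ('n + 'p::finite, complex) mfps" where
  "decomp_summand a b c k = (\<Sum>l = 1..k. \<Sum>i\<in>{i. (\<Sum>s\<in>UNIV. i s) = k}. \<Sum>j\<in>{j. (\<Sum>t\<in>UNIV. j t) = l}.
     decomp_term a b c k l i j)"

lemma sum_factor:
  fixes A :: "'a::comm_semiring_0"
  shows "(\<Sum>i\<in>I. \<Sum>j\<in>J. A * f i * g j) = A * (\<Sum>i\<in>I. f i) * (\<Sum>j\<in>J. g j)"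
  unfolding mult.assoc sum_product by (simp add: sum_distrib_left)

lemma mfps_coeff_decomp_summand:
  fixes m :: "'n::finite + 'p::finite \<Rightarrow> nat"
  defines "M \<equiv> \<Sum>s\<in>UNIV. m (Inl s)" and "N \<equiv> \<Sum>t\<in>UNIV. m (Inr t)"
  shows "mfps_coeff (decomp_summand a b c k) m
    = (-1) ^ N / pochhammer (1 - a) N
      * (\<Prod>s\<in>UNIV. pochhammer (b s) (m (Inl s)) / (fact (m (Inl s)) * pochhammer (c s) (m (Inl s))))
      * (\<Prod>t\<in>UNIV. 1 / fact (m (Inr t)))
      * (\<Sum>l = 1..k. of_nat ((k - 1) choose (l - 1)) * ((-1) ^ k * fact k) * pochhammer (a + of_nat k) (M - k)
          * of_nat (M choose k) * of_nat (N choose l))"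
proof -
  let ?P = "(-1) ^ N / pochhammer (1 - a) N
      * (\<Prod>s\<in>UNIV. pochhammer (b s) (m (Inl s)) / (fact (m (Inl s)) * pochhammer (c s) (m (Inl s))))
      * (\<Prod>t\<in>UNIV. 1 / fact (m (Inr t)))"
  let ?W = "\<lambda>l. of_nat ((k - 1) choose (l - 1)) * ((-1) ^ k * fact k) * pochhammer (a + of_nat k) (M - k)"
  have "mfps_coeff (decomp_summand a b c k) m
     = (\<Sum>l = 1..k. \<Sum>i\<in>{i. (\<Sum>s\<in>UNIV. i s) = k}. \<Sum>j\<in>{j. (\<Sum>t\<in>UNIV. j t) = l}.
         ?P * ?W l * of_nat (\<Prod>s\<in>UNIV. m (Inl s) choose i s) * of_nat (\<Prod>t\<in>UNIV. m (Inr t) choose j t))"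
    unfolding decomp_summand_def mfps_coeff_sum M_def N_def
    by (intro sum.cong refl) (simp only: mem_Collect_eq mfps_coeff_decomp_term)
  also have "\<dots> = (\<Sum>l = 1..k. ?P * ?W l
        * of_nat (\<Sum>i\<in>{i. (\<Sum>s\<in>UNIV. i s) = k}. \<Prod>s\<in>UNIV. m (Inl s) choose i s)
        * of_nat (\<Sum>j\<in>{j. (\<Sum>t\<in>UNIV. j t) = l}. \<Prod>t\<in>UNIV. m (Inr t) choose j t))"
    unfolding of_nat_sum by (intro sum.cong refl sum_factor)
  also have "\<dots> = (\<Sum>l = 1..k. ?P * ?W l * of_nat (M choose k) * of_nat (N choose l))"
    unfolding sum_prod_choose M_def N_def ..
  finally show ?thesis
    by (simp only: sum_distrib_left mult.assoc)
qed

lemma mfps_coeff_decomp_summand_eq_0: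
  assumes "k > (\<Sum>s\<in>UNIV. m (Inl s))"
  shows "mfps_coeff (decomp_summand a b c k) m = 0"
  using assms by (simp add: mfps_coeff_decomp_summand binomial_eq_0)

theorem mainTheorem2:
  fixes a :: complex and b c :: "'n::finite \<Rightarrow> complex"
  assumes "\<And>r::nat. r \<ge> 1 \<Longrightarrow> a \<noteq> of_nat r"
    and "\<And>i. c i \<notin> \<int>\<^sub>\<le>\<^sub>0"
  shows "\<exists>S :: ('n + 'p::finite, complex) mfps.
    mfps_has_sum
      (\<lambda>k. \<Sum>l = 1..k. \<Sum>i\<in>{i :: 'n \<Rightarrow> nat. (\<Sum>s\<in>UNIV. i s) = k}. \<Sum>j\<in>{j :: 'p \<Rightarrow> nat. (\<Sum>t\<in>UNIV. j t) = l}.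
         mfps_const
           (of_nat ((k - 1) choose (l - 1))
             * ((-1) ^ (k + l) * fact k * (\<Prod>s\<in>UNIV. pochhammer (b s) (i s))
                / (pochhammer (1 - a) l * (\<Prod>s\<in>UNIV. pochhammer (c s) (i s)))))
         * (\<Prod>s\<in>UNIV. mfps_const (1 / fact (i s)) * mfps_X (Inl s) ^ i s)
         * (\<Prod>t\<in>UNIV. mfps_const (1 / fact (j t)) * mfps_X (Inr t) ^ j t)
         * mfps_rename Inl (F_A (a + of_nat k) (\<lambda>s. b s + of_nat (i s)) (\<lambda>s. c s + of_nat (i s)))
         * mfps_rename Inr (mfps_neg_arg (F_0p (1 - a + of_nat l))))
      {1..} S \<and>
    H_A a b c = mfps_rename Inl (F_A a b c) * mfps_rename Inr (mfps_neg_arg (F_0p (1 - a))) + S"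
proof -
  have a: "a \<notin> of_nat ` {1..}"
    using assms(1) by auto
  let ?deg = "\<lambda>m :: 'n + 'p \<Rightarrow> nat. \<Sum>s\<in>UNIV. m (Inl s)"
  define S :: "('n + 'p, complex) mfps" where
    "S = Abs_mfps (\<lambda>m. \<Sum>k = 1..?deg m. mfps_coeff (decomp_summand a b c k) m)"
  have supp: "{k \<in> {1..}. mfps_coeff (decomp_summand a b c k) m \<noteq> 0} \<subseteq> {1..?deg m}" for m :: "'n + 'p \<Rightarrow> nat"
    using mfps_coeff_decomp_summand_eq_0[of m _ a b c] by (auto simp: not_less [symmetric])
  have "mfps_has_sum (decomp_summand a b c) {1..} S"
    unfolding mfps_has_sum_def
  proof (intro allI conjI)
    fix m
    show "finite {k \<in> {1..}. mfps_coeff (decomp_summand a b c k :: ('n + 'p, complex) mfps) m \<noteq> 0}"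
      using supp[of m] by (rule finite_subset) simp
    show "mfps_coeff S m = (\<Sum>k\<in>{k \<in> {1..}. mfps_coeff (decomp_summand a b c k) m \<noteq> 0}.
        mfps_coeff (decomp_summand a b c k) m)"
      unfolding S_def mfps_coeff_Abs using supp[of m] by (intro sum.mono_neutral_right) auto
  qed
  moreover have "H_A a b c = mfps_rename Inl (F_A a b c) * mfps_rename Inr (mfps_neg_arg (F_0p (1 - a))) + S"
  proof (rule mfps_eqI)
    fix m :: "'n + 'p \<Rightarrow> nat"
    have distrib: "u * (A + B) * P * Q = A * P * (u * Q) + u * P * Q * B" for u A B P Q :: complex
      by (simp add: algebra_simps)
    show "mfps_coeff (H_A a b c) m
      = mfps_coeff (mfps_rename Inl (F_A a b c) * mfps_rename Inr (mfps_neg_arg (F_0p (1 - a))) + S) m"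
      unfolding mfps_coeff_H_A poch_int_expansion[OF a] mfps_coeff_add mfps_coeff_rename_mult
        mfps_coeff_F_A mfps_coeff_F_0p_neg S_def mfps_coeff_Abs mfps_coeff_decomp_summand
        sum_distrib_left [symmetric] comp_def
      by (rule distrib)
  qed
  ultimately show ?thesis
    unfolding decomp_summand_def decomp_term_def by blast
qed

end
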